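(* For each $d\in\mathbb{N}$ with $d\ge2$ there is a $d$-dimensional Banach space with a basis that satisfies Property (A) and has suppression unconditionality constant $K_s\ge10/9$.
   Context: Spaces are over $\mathbb{F}=\mathbb{R}$ or $\mathbb{C}$; $\mathbb{E}=\{\lambda\in\mathbb{F}:|\lambda|=1\}$. For a basis $(\boldsymbol{x}_n)_{n=1}^d$ (in the linear algebra sense) of a $d$-dimensional normed space $\mathbb{X}$, let $(\boldsymbol{x}_n^* )_{n=1}^d$ be the dual basis of $\mathbb{X}^*$, $\operatorname{supp}(f)=\{n:\boldsymbol{x}_n^*(f)\ne0\}$, $\mathbb{1}_{\varepsilon,A}=\sum_{n\in A}\varepsilon_n\boldsymbol{x}_n$ and $S_A(x)=\sum_{n\in A}\boldsymbol{x}_n^*(x)\boldsymbol{x}_n$ for $A\subset\{1,\dots,d\}$. Property (A): $\|\mathbb{1}_{\varepsilon,A}+f\|\le\|\mathbb{1}_{\varepsilon,B}+f\|$ for all $f\in\mathbb{X}$ with $\max_n|\boldsymbol{x}_n^*(f)|\le1$, all $A,B\subset\{1,\dots,d\}$ with $|A|\le|B|$ and $A\cap B=A\cap\operatorname{supp}(f)=B\cap\operatorname{supp}(f)=\emptyset$, and all $\varepsilon\in\mathbb{E}^{A\cup B}$. $K_s$ is the smallest $K$ such that $\|S_A(x)\|\le K\|x\|$ for all $A\subset\{1,\dots,d\}$ and $x\in\mathbb{X}$. *)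

theory Defs
  imports Complex_Main "HOL-Library.Function_Algebras"
begin

text \<open>
  The space is a subspace \<open>V\<close> of an ambient vector space, with a norm \<open>N\<close> whose values matter only
  on \<open>V\<close>. The scalar field \<open>'f\<close> is to be instantiated with \<^typ>\<open>real\<close> and \<^typ>\<open>complex\<close>; \<^term>\<open>norm\<close>
  on scalars is the absolute value.
\<close>

locale normed_space_on = vector_space scale
  for scale :: "'f::real_normed_field \<Rightarrow> 'v::ab_group_add \<Rightarrow> 'v" +
  fixes V :: "'v set" and N :: "'v \<Rightarrow> real"
  assumes subspace_V: "subspace V"
    and N_nonneg: "v \<in> V \<Longrightarrow> 0 \<le> N v"
    and N_eq_0_iff: "v \<in> V \<Longrightarrow> N v = 0 \<longleftrightarrow> v = 0"
    and N_scale: "v \<in> V \<Longrightarrow> N (scale c v) = norm c * N v"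
    and N_triangle: "v \<in> V \<Longrightarrow> w \<in> V \<Longrightarrow> N (v + w) \<le> N v + N w"

locale banach_space_on = normed_space_on +
  assumes complete_V:
    "(\<And>n::nat. s n \<in> V) \<Longrightarrow> (\<And>e. e > 0 \<Longrightarrow> \<exists>M. \<forall>m\<ge>M. \<forall>n\<ge>M. N (s m - s n) < e)
      \<Longrightarrow> \<exists>l\<in>V. (\<lambda>n. N (s n - l)) \<longlonglongrightarrow> 0"

locale basis_on = normed_space_on +
  fixes d :: nat and x :: "nat \<Rightarrow> 'b"
  assumes inj_x: "inj_on x {1..d}"
    and independent_x: "independent (x ` {1..d})"
    and span_x: "span (x ` {1..d}) = V"
begin

text \<open>The dual basis functional \<open>x\<^sub>n\<^sup>*\<close>, for \<open>n \<in> {1..d}\<close> and \<open>f \<in> V\<close>.\<close>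

definition coord :: "nat \<Rightarrow> 'b \<Rightarrow> 'a"
  where "coord n f = representation (x ` {1..d}) f (x n)"

definition supp :: "'b \<Rightarrow> nat set"
  where "supp f = {n \<in> {1..d}. coord n f \<noteq> 0}"

definition signed_ind :: "(nat \<Rightarrow> 'a) \<Rightarrow> nat set \<Rightarrow> 'b"
  where "signed_ind \<epsilon> A = (\<Sum>n\<in>A. scale (\<epsilon> n) (x n))"

definition coord_proj :: "nat set \<Rightarrow> 'b \<Rightarrow> 'b"
  where "coord_proj A f = (\<Sum>n\<in>A. scale (coord n f) (x n))"

definition property_A :: bool
  where "property_A \<longleftrightarrow>
    (\<forall>f\<in>V. \<forall>A B \<epsilon>.
      (\<forall>n\<in>{1..d}. norm (coord n f) \<le> 1) \<and>
      A \<subseteq> {1..d} \<and> B \<subseteq> {1..d} \<and> card A \<le> card B \<and>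
      A \<inter> B = {} \<and> A \<inter> supp f = {} \<and> B \<inter> supp f = {} \<and>
      (\<forall>n\<in>A \<union> B. norm (\<epsilon> n) = 1) \<longrightarrow>
      N (signed_ind \<epsilon> A + f) \<le> N (signed_ind \<epsilon> B + f))"

text \<open>The suppression unconditionality constant \<open>K\<^sub>s\<close>; in finite dimension the least constant exists
  as soon as \<open>d \<ge> 1\<close>.\<close>

definition suppression_const :: real
  where "suppression_const =
    (LEAST K. \<forall>A\<subseteq>{1..d}. \<forall>f\<in>V. N (coord_proj A f) \<le> K * N f)"

end

definition fun_scale :: "'f::times \<Rightarrow> ('i \<Rightarrow> 'f) \<Rightarrow> 'i \<Rightarrow> 'f"
  where "fun_scale c v = (\<lambda>i. c * v i)"

end

theory Submission
  imports Defs
begin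

text \<open>
  Property (A) restricts a norm only where entries of largest modulus are exchanged, deleted or
  added. A norm may therefore see cancellation among the small entries, provided that the effect
  disappears as soon as two entries tie for the largest modulus. For \<open>d \<ge> 3\<close> take the maximum of
  two families of seminorms. The signed part \<open>\<bar>v\<^sub>i\<bar> + \<bar>v\<^sub>1 + v\<^sub>2\<bar> / 3\<close> (with \<open>v\<^sub>i\<close> left out of the
  second summand) may decide the norm when one entry dominates. The lattice part
  \<open>(2 \<bar>v\<^sub>i\<bar> + 2 \<bar>v\<^sub>j\<bar> + \<bar>v\<^sub>k\<bar>) / 3\<close>, over all triples of distinct indices, is symmetric and depends on
  moduli only; it takes over when two entries tie for the maximum. The vector with leading entries
  \<open>1/3, -1/3, 1\<close> has norm 1, because its first two entries cancel; deleting the second one raises the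
  signed part to \<open>1 + 1/9 = 10/9\<close>.

  The constants come from an optimisation. With \<open>c \<bar>v\<^sub>1 + v\<^sub>2\<bar>\<close> in the signed part, the lattice part has
  to dominate \<open>1 + c (1 + t)\<close> at vectors whose ordered moduli are \<open>1, 1, t\<close>. The choice that meets this
  with equality assigns \<open>(1 + c) (1 + s) / 2 + c s\<close> to moduli \<open>1, s, s\<close>. Cancelling entries of modulus
  \<open>s\<close> do no harm while this is at most 1, that is, for \<open>s \<le> (1 - c) / (1 + 3 c)\<close>. The gain
  \<open>c s = c (1 - c) / (1 + 3 c)\<close> is then largest at \<open>c = s = 1/3\<close>, where it equals \<open>1/9\<close>.

  In \<open>property_A_space\<close> every seminorm of the smaller vector is compared with one of the larger
  vector, by moving indices along a permutation that carries \<open>A\<close> into \<open>B\<close>. All signed parts are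
  dominated by lattice parts, except the one at \<open>a\<close> when \<open>A = {a}\<close> and \<open>B = {b}\<close>; that one agrees with
  the signed part at \<open>b\<close>, since both add to the modulus 1 the same quantity computed from \<open>f\<close>.

  In the plane there are no triples, but the exchange condition there says only that the two basis
  vectors have equal norm, so the relative sign of the two entries may be used directly. The norm
  \<open>max {\<bar>v\<^sub>1 - v\<^sub>2 / 2\<bar>, \<bar>v\<^sub>2 - v\<^sub>1 / 2\<bar>, (\<bar>v\<^sub>1\<bar> + \<bar>v\<^sub>2\<bar>) / 2}\<close> is \<open>3/4\<close> at \<open>(1, 1/2)\<close> and 1 at \<open>(1, 0)\<close>.
  Both constructions refer to scalars only through absolute values and rational multiples, so they
  serve the real and the complex field alike.
\<close>

section \<open>Norms on the coordinate space\<close>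

lemma sum_fun_apply: "(\<Sum>i\<in>A. g i) n = (\<Sum>i\<in>A. g i n)"
  for g :: "'i \<Rightarrow> 'n \<Rightarrow> 'f::comm_monoid_add"
  by (induction A rule: infinite_finite_induct) auto

lemma vector_space_fun_scale: "vector_space (fun_scale :: 'f::field \<Rightarrow> ('i \<Rightarrow> 'f) \<Rightarrow> _)"
  by unfold_locales (auto simp: fun_scale_def algebra_simps)

definition coordinate_space :: "nat \<Rightarrow> (nat \<Rightarrow> 'f::zero) set"
  where "coordinate_space d = {v. \<forall>n. n \<notin> {1..d} \<longrightarrow> v n = 0}"

definition unit_vector :: "nat \<Rightarrow> nat \<Rightarrow> 'f::zero_neq_one"
  where "unit_vector n = (\<lambda>i. if i = n then 1 else 0)"

lemma unit_vector_apply: "unit_vector n i = (if i = n then 1 else 0)"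
  by (simp add: unit_vector_def)

text \<open>
  The bound on the coordinates makes \<open>N\<close> definite on the coordinate space. Together with the expansion
  in unit vectors it also makes \<open>N\<close> equivalent there to the maximum norm, which yields completeness
  and the boundedness of the coordinate projections.
\<close>
locale coordinate_norm =
  fixes d :: nat and N :: "(nat \<Rightarrow> 'f::{real_normed_field,banach}) \<Rightarrow> real" and C :: real
  assumes scale: "N (fun_scale c v) = norm c * N v"
    and triangle: "N (v + w) \<le> N v + N w"
    and coordinate_le: "n \<in> {1..d} \<Longrightarrow> norm (v n) \<le> C * N v"
    and C_ge_0: "0 \<le> C"
begin

abbreviation V :: "(nat \<Rightarrow> 'f) set"
  where "V \<equiv> coordinate_space d"

sublocale vector_space "fun_scale :: 'f \<Rightarrow> (nat \<Rightarrow> 'f) \<Rightarrow> _"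
  by (rule vector_space_fun_scale)

lemma N_zero: "N 0 = 0"
  using scale[of 0 0] by (simp add: fun_scale_def zero_fun_def)

lemma N_ge_0: "0 \<le> N v"
proof -
  have "N (v + fun_scale (- 1) v) \<le> N v + N v"
    using triangle[of v "fun_scale (- 1) v"] by (simp only: scale) simp
  moreover have "v + fun_scale (- 1) v = 0"
    by (auto simp: fun_scale_def)
  ultimately show ?thesis
    by (simp add: N_zero)
qed

lemma N_sum_le: "N (\<Sum>i\<in>I. g i) \<le> (\<Sum>i\<in>I. N (g i))"
proof (induction I rule: infinite_finite_induct)
  case (insert i I)
  then show ?case
    using order_trans[OF triangle[of "g i" "sum g I"] add_left_mono]
    by (simp only: sum.insert not_False_eq_True)
qed (simp_all only: sum.infinite sum.empty N_zero order_refl not_False_eq_True)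

lemma expansion:
  assumes "v \<in> V"
  shows "v = (\<Sum>n\<in>{1..d}. fun_scale (v n) (unit_vector n))"
proof
  fix i
  show "v i = (\<Sum>n\<in>{1..d}. fun_scale (v n) (unit_vector n)) i"
    using assms
    by (auto simp: sum_fun_apply fun_scale_def unit_vector_def coordinate_space_def if_distrib
        sum.delta cong: if_cong)
qed

lemma N_le:
  assumes "v \<in> V"
  shows "N v \<le> (\<Sum>n\<in>{1..d}. norm (v n) * N (unit_vector n))"
  by (subst expansion[OF assms]) (rule order_trans[OF N_sum_le], simp add: scale)

lemma subspace_space: "subspace V"
  by (rule subspaceI) (auto simp: coordinate_space_def fun_scale_def)

lemma normed: "normed_space_on fun_scale V N"
proof unfold_locales
  fix v assume v: "v \<in> V"
  have "v = 0" if "N v = 0"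
  proof
    fix n
    show "v n = 0 n"
      using coordinate_le[of n v] v that by (cases "n \<in> {1..d}") (auto simp: coordinate_space_def)
  qed
  then show "N v = 0 \<longleftrightarrow> v = 0"
    by (auto simp: N_zero)
qed (use subspace_space N_ge_0 scale triangle in auto)

text \<open>
  A Cauchy sequence converges in every coordinate, and by \<open>N_le\<close> convergence in the finitely many
  coordinates implies convergence in norm.
\<close>
lemma banach: "banach_space_on fun_scale V N"
proof -
  interpret normed_space_on fun_scale V N by (rule normed)
  show ?thesis
  proof unfold_locales
    fix s :: "nat \<Rightarrow> nat \<Rightarrow> 'f"
    assume s: "\<And>n. s n \<in> V"
      and Cauchy_s: "\<And>e. e > 0 \<Longrightarrow> \<exists>M. \<forall>m\<ge>M. \<forall>n\<ge>M. N (s m - s n) < e"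
    have "convergent (\<lambda>m. s m n)" if n: "n \<in> {1..d}" for n
    proof (rule Cauchy_convergent, rule CauchyI)
      fix e :: real assume "0 < e"
      then obtain M where M: "\<forall>m\<ge>M. \<forall>n\<ge>M. N (s m - s n) < e / (C + 1)"
        using Cauchy_s[of "e / (C + 1)"] C_ge_0 by auto
      have "norm (s m n - s k n) < e" if "m \<ge> M" "k \<ge> M" for m k
      proof -
        have "norm (s m n - s k n) \<le> C * N (s m - s k)"
          using coordinate_le[OF n, of "s m - s k"] by simp
        also have "\<dots> \<le> (C + 1) * N (s m - s k)"
          using N_ge_0 by (intro mult_right_mono) auto
        also have "\<dots> < e"
          using M that C_ge_0 by (auto simp: field_simps)
        finally show ?thesis .
      qed
      then show "\<exists>M. \<forall>m\<ge>M. \<forall>k\<ge>M. norm (s m n - s k n) < e"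
        by blast
    qed
    then obtain L where L: "\<And>n. n \<in> {1..d} \<Longrightarrow> (\<lambda>m. s m n) \<longlonglongrightarrow> L n"
      unfolding convergent_def by metis
    define l where "l = (\<lambda>n. if n \<in> {1..d} then L n else 0)"
    have l: "l \<in> V"
      by (auto simp: l_def coordinate_space_def)
    have sl: "s m - l \<in> V" for m
      using s[of m] l by (auto simp: coordinate_space_def)
    have "(\<lambda>m. \<Sum>n\<in>{1..d}. norm ((s m - l) n) * N (unit_vector n))
        \<longlonglongrightarrow> (\<Sum>n\<in>{1..d}. norm (0 :: 'f) * N (unit_vector n))"
    proof (intro tendsto_sum tendsto_mult tendsto_norm tendsto_const)
      fix n assume "n \<in> {1..d}"
      then show "(\<lambda>m. (s m - l) n) \<longlonglongrightarrow> 0"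
        using L[of n] by (auto simp: l_def LIM_zero_iff)
    qed
    then have "(\<lambda>m. N (s m - l)) \<longlonglongrightarrow> 0"
      by (intro tendsto_sandwich[where f = "\<lambda>_. 0" and g = "\<lambda>m. N (s m - l)"])
        (use N_ge_0 N_le[OF sl] in \<open>auto simp del: fun_diff_def minus_apply\<close>)
    with l show "\<exists>l\<in>V. (\<lambda>n. N (s n - l)) \<longlonglongrightarrow> 0"
      by blast
  qed
qed

lemma inj_unit_vector: "inj_on (unit_vector :: nat \<Rightarrow> nat \<Rightarrow> 'f) X"
  by (auto simp: inj_on_def unit_vector_def fun_eq_iff split: if_splits)

lemma independent_unit_vectors: "independent ((unit_vector :: nat \<Rightarrow> nat \<Rightarrow> 'f) ` {1..d})"
proof -
  have "u (unit_vector n) = 0"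
    if "(\<Sum>b\<in>unit_vector ` {1..d}. fun_scale (u b) b) = 0" "n \<in> {1..d}"
    for u :: "(nat \<Rightarrow> 'f) \<Rightarrow> 'f" and n
  proof -
    have "(\<Sum>k\<in>{1..d}. fun_scale (u (unit_vector k)) (unit_vector k)) n = 0"
      using that by (simp add: sum.reindex[OF inj_unit_vector])
    then have "(\<Sum>k\<in>{1..d}. if n = k then u (unit_vector k) else 0) = 0"
      by (simp add: sum_fun_apply fun_scale_def unit_vector_apply if_distrib cong: if_cong)
    then show ?thesis
      using that(2) by simp
  qed
  then show ?thesis
    by (intro independent_if_scalars_zero) auto
qed

lemma span_unit_vectors: "span (unit_vector ` {1..d}) = V"
proof
  show "span (unit_vector ` {1..d}) \<subseteq> V"
    by (rule span_minimal[OF _ subspace_space]) (auto simp: coordinate_space_def unit_vector_def)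
  show "V \<subseteq> span (unit_vector ` {1..d})"
  proof
    fix v assume "v \<in> V"
    then show "v \<in> span (unit_vector ` {1..d})"
      by (subst expansion) (auto simp only: intro!: span_sum span_scale span_base[OF imageI])
  qed
qed

lemma dim_V: "dim V = d"
  using dim_span_eq_card_independent[OF independent_unit_vectors]
  unfolding span_unit_vectors card_image[OF inj_unit_vector] by simp

lemma basis: "basis_on fun_scale V N d unit_vector"
  using normed inj_unit_vector independent_unit_vectors span_unit_vectors
  by (intro basis_on.intro basis_on_axioms.intro)

sublocale basis_on fun_scale V N d unit_vector
  by (rule basis)

lemma coord_eq:
  assumes v: "v \<in> V" and n: "n \<in> {1..d}"
  shows "coord n v = v n"
proof -
  let ?B = "unit_vector ` {1..d} :: (nat \<Rightarrow> 'f) set"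
  have in_span: "unit_vector k \<in> span ?B" if "k \<in> {1..d}" for k
    using that by (intro span_base imageI)
  have "representation ?B (\<Sum>k\<in>{1..d}. fun_scale (v k) (unit_vector k)) (unit_vector n)
      = (\<Sum>k\<in>{1..d}. representation ?B (fun_scale (v k) (unit_vector k)) (unit_vector n))"
    by (rule fun_cong[OF representation_sum[OF independent_unit_vectors], THEN trans])
      (auto simp only: intro!: span_scale in_span)
  also have "\<dots> = (\<Sum>k\<in>{1..d}. v k * representation ?B (unit_vector k) (unit_vector n))"
    by (intro sum.cong refl) (simp only: representation_scale[OF independent_unit_vectors in_span])
  also have "\<dots> = (\<Sum>k\<in>{1..d}. v k * (if k = n then 1 else 0))"
    using independent_unit_vectors inj_unit_vector[of UNIV]
    by (intro sum.cong refl) (auto simp: representation_basis inj_on_def)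
  also have "\<dots> = v n"
    using n by (simp add: if_distrib cong: if_cong)
  finally show ?thesis
    unfolding coord_def using expansion[OF v] by simp
qed

lemma supp_eq:
  assumes "v \<in> V"
  shows "supp v = {n. v n \<noteq> 0}"
proof -
  have "supp v = {n \<in> {1..d}. v n \<noteq> 0}"
    unfolding supp_def using coord_eq[OF assms] by (intro Collect_cong) metis
  with assms show ?thesis
    by (auto simp: coordinate_space_def)
qed

lemma coord_proj_eq:
  assumes "v \<in> V" "A \<subseteq> {1..d}"
  shows "coord_proj A v = (\<lambda>n. if n \<in> A then v n else 0)"
proof
  fix i
  have "coord_proj A v i = (\<Sum>n\<in>A. if i = n then v i else 0)"
    using assms by (auto simp: coord_proj_def sum_fun_apply fun_scale_def unit_vector_def coord_eq
        subset_iff intro!: sum.cong)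
  then show "coord_proj A v i = (if i \<in> A then v i else 0)"
    using finite_subset[OF assms(2)] by simp
qed

lemma signed_ind_plus:
  assumes "v \<in> V" "A \<subseteq> {1..d}" "A \<inter> supp v = {}"
  shows "signed_ind \<epsilon> A + v = override_on v \<epsilon> A"
proof
  fix i
  have "signed_ind \<epsilon> A i = (\<Sum>n\<in>A. if i = n then \<epsilon> i else 0)"
    by (auto simp: signed_ind_def sum_fun_apply fun_scale_def unit_vector_def intro!: sum.cong)
  then show "(signed_ind \<epsilon> A + v) i = override_on v \<epsilon> A i"
    using finite_subset[OF assms(2)] assms(1,3) by (auto simp: supp_eq override_on_def)
qed

text \<open>
  Since \<open>f\<close> vanishes on \<open>A\<close>, adding the signed indicator of \<open>A\<close> to it overwrites its entries on \<open>A\<close>.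
\<close>
lemma property_A_I:
  assumes "\<And>f A B \<epsilon>. \<lbrakk>f \<in> V; \<And>n. norm (f n) \<le> 1; A \<subseteq> {1..d}; B \<subseteq> {1..d}; card A \<le> card B;
      A \<inter> B = {}; \<And>n. n \<in> A \<union> B \<Longrightarrow> f n = 0; \<And>n. n \<in> A \<union> B \<Longrightarrow> norm (\<epsilon> n) = 1\<rbrakk>
      \<Longrightarrow> N (override_on f \<epsilon> A) \<le> N (override_on f \<epsilon> B)"
  shows property_A
  unfolding property_A_def
proof (intro ballI allI impI, elim conjE)
  fix f A B and \<epsilon> :: "nat \<Rightarrow> 'f"
  assume f: "f \<in> V" and le: "\<forall>n\<in>{1..d}. norm (coord n f) \<le> 1"
    and sets: "A \<subseteq> {1..d}" "B \<subseteq> {1..d}" "card A \<le> card B" "A \<inter> B = {}"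
    and disjoint: "A \<inter> supp f = {}" "B \<inter> supp f = {}"
    and \<epsilon>: "\<forall>n\<in>A \<union> B. norm (\<epsilon> n) = 1"
  have "norm (f n) \<le> 1" for n
    using le f by (cases "n \<in> {1..d}") (auto simp: coord_eq coordinate_space_def)
  moreover have "f n = 0" if "n \<in> A \<union> B" for n
    using that disjoint f by (auto simp: supp_eq)
  ultimately show "N (signed_ind \<epsilon> A + f) \<le> N (signed_ind \<epsilon> B + f)"
    using assms[of f A B \<epsilon>] f sets disjoint \<epsilon> by (simp add: signed_ind_plus)
qed

lemma coord_proj_le:
  assumes v: "v \<in> V" and A: "A \<subseteq> {1..d}"
  shows "N (coord_proj A v) \<le> (\<Sum>n\<in>{1..d}. C * N (unit_vector n)) * N v"
proof -
  have "coord_proj A v \<in> V"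
    using A by (auto simp: coord_proj_eq[OF v A] coordinate_space_def)
  then have "N (coord_proj A v) \<le> (\<Sum>n\<in>{1..d}. norm (coord_proj A v n) * N (unit_vector n))"
    by (rule N_le)
  also have "\<dots> \<le> (\<Sum>n\<in>{1..d}. (C * N v) * N (unit_vector n))"
  proof (intro sum_mono mult_right_mono N_ge_0)
    fix n assume "n \<in> {1..d}"
    then show "norm (coord_proj A v n) \<le> C * N v"
      using coordinate_le[of n v] order_trans[OF norm_ge_zero coordinate_le, of n v]
      by (simp add: coord_proj_eq[OF v A])
  qed
  finally show ?thesis
    by (simp add: sum_distrib_left mult_ac)
qed

text \<open>
  A witness bounds every admissible constant from below. To conclude the same for the least one, it has
  to be shown that the least one exists: the infimum of the admissible constants is itself admissible,
  because each of the defining inequalities is closed in \<open>K\<close>, and the set of admissible constants is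
  nonempty by \<open>coord_proj_le\<close>.
\<close>
lemma suppression_const_ge:
  assumes f: "f \<in> V" and A: "A \<subseteq> {1..d}" and pos: "0 < N f"
    and ratio: "r * N f \<le> N (\<lambda>n. if n \<in> A then f n else 0)"
  shows "r \<le> suppression_const"
proof -
  define S where "S = {K. \<forall>A\<subseteq>{1..d}. \<forall>f\<in>V. N (coord_proj A f) \<le> K * N f}"
  have "(\<Sum>n\<in>{1..d}. C * N (unit_vector n)) \<in> S"
    using coord_proj_le by (auto simp: S_def)
  then have ne: "S \<noteq> {}"
    by blast
  have lower: "N (coord_proj A f) / N f \<le> K"
    if "K \<in> S" "f \<in> V" "A \<subseteq> {1..d}" "0 < N f" for K f A
    using that by (auto simp: S_def field_simps)
  then have bdd: "bdd_below S"
    using f A pos unfolding bdd_below_def by blast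
  have "\<forall>A\<subseteq>{1..d}. \<forall>f\<in>V. N (coord_proj A f) \<le> Inf S * N f"
  proof (intro allI impI ballI)
    fix A g assume A: "A \<subseteq> {1..d}" and g: "g \<in> V"
    show "N (coord_proj A g) \<le> Inf S * N g"
    proof (cases "N g = 0")
      case True
      then show ?thesis
        using coord_proj_le[OF g A] by simp
    next
      case False
      then have "0 < N g"
        using N_ge_0[of g] by simp
      moreover from this have "N (coord_proj A g) / N g \<le> Inf S"
        using lower g A by (intro cInf_greatest[OF ne]) auto
      ultimately show ?thesis
        by (simp add: field_simps)
    qed
  qed
  then have Inf_S: "Inf S \<in> S"
    by (subst (2) S_def) simp
  have "suppression_const = (LEAST K. K \<in> S)"
    by (simp add: suppression_const_def S_def)
  also have "\<dots> = Inf S"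
    using Inf_S by (rule Least_equality) (rule cInf_lower[OF _ bdd])
  finally have "suppression_const \<in> S"
    using Inf_S by simp
  then have "r * N f \<le> suppression_const * N f"
    using ratio f A by (auto simp: S_def coord_proj_eq intro: order_trans)
  with pos show ?thesis
    by simp
qed

end

lemma coordinate_norm_example:
  fixes N :: "(nat \<Rightarrow> 'f::{real_normed_field,banach}) \<Rightarrow> real"
  assumes "coordinate_norm d N C" "basis_on.property_A fun_scale (coordinate_space d) N d unit_vector"
    and "r \<le> basis_on.suppression_const fun_scale (coordinate_space d) N d unit_vector"
  shows "\<exists>(V :: (nat \<Rightarrow> 'f) set) N x.
        banach_space_on fun_scale V N \<and>
        vector_space.dim fun_scale V = d \<and>
        basis_on fun_scale V N d x \<and>
        basis_on.property_A fun_scale V N d x \<and>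
        basis_on.suppression_const fun_scale V N d x \<ge> r"
  using assms coordinate_norm.banach[OF assms(1)] coordinate_norm.dim_V[OF assms(1)]
    coordinate_norm.basis[OF assms(1)]
  by blast

section \<open>The plane\<close>

definition plane_norm :: "(nat \<Rightarrow> 'f::real_normed_field) \<Rightarrow> real"
  where "plane_norm v =
    max (max (norm (v 1 - v 2 / 2)) (norm (v 2 - v 1 / 2))) ((norm (v 1) + norm (v 2)) / 2)"

lemma coordinate_norm_plane:
  "coordinate_norm 2 (plane_norm :: (nat \<Rightarrow> 'f::{real_normed_field,banach}) \<Rightarrow> real) 2"
proof
  fix c and v w :: "nat \<Rightarrow> 'f"
  have factor: "norm (c * x - c * y / 2) = norm c * norm (x - y / 2)" for x y :: 'f
    by (metis norm_mult right_diff_distrib times_divide_eq_right)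
  have average: "(norm (c * x) + norm (c * y)) / 2 = norm c * ((norm x + norm y) / 2)" for x y :: 'f
    by (simp add: norm_mult distrib_left)
  show "plane_norm (fun_scale c v) = norm c * plane_norm v"
    unfolding plane_norm_def fun_scale_def factor average
    by (simp only: max_mult_distrib_left norm_ge_zero if_True)
  have le: "norm (u 1 - u 2 / 2) \<le> plane_norm u" "norm (u 2 - u 1 / 2) \<le> plane_norm u"
    "(norm (u 1) + norm (u 2)) / 2 \<le> plane_norm u" for u :: "nat \<Rightarrow> 'f"
    by (simp_all add: plane_norm_def)
  have "norm ((v m + w m) - (v n + w n) / 2) \<le> norm (v m - v n / 2) + norm (w m - w n / 2)" for m n
    by (rule order_trans[OF eq_refl norm_triangle_ineq]) (simp add: add_divide_distrib algebra_simps)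
  note difference = this
  show "plane_norm (v + w) \<le> plane_norm v + plane_norm w"
    unfolding plane_norm_def[of "v + w"] unfolding plus_fun_def
  proof (intro max.boundedI)
    show "norm (v 1 + w 1 - (v 2 + w 2) / 2) \<le> plane_norm v + plane_norm w"
      by (rule order_trans[OF difference add_mono[OF le(1) le(1)]])
    show "norm (v 2 + w 2 - (v 1 + w 1) / 2) \<le> plane_norm v + plane_norm w"
      by (rule order_trans[OF difference add_mono[OF le(2) le(2)]])
    have "norm (v 1 + w 1) + norm (v 2 + w 2) \<le> (norm (v 1) + norm (v 2)) + (norm (w 1) + norm (w 2))"
      using norm_triangle_ineq[of "v 1" "w 1"] norm_triangle_ineq[of "v 2" "w 2"] by linarith
    then have "(norm (v 1 + w 1) + norm (v 2 + w 2)) / 2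
        \<le> (norm (v 1) + norm (v 2)) / 2 + (norm (w 1) + norm (w 2)) / 2"
      unfolding add_divide_distrib[symmetric] by (rule divide_right_mono) simp
    then show "(norm (v 1 + w 1) + norm (v 2 + w 2)) / 2 \<le> plane_norm v + plane_norm w"
      by (rule order_trans[OF _ add_mono[OF le(3) le(3)]])
  qed
  show "norm (v n) \<le> 2 * plane_norm v" if "n \<in> {1..2}" for n
  proof -
    have "n = 1 \<or> n = 2"
      using that by auto
    then have "norm (v n) \<le> norm (v 1) + norm (v 2)"
      by auto
    also have "\<dots> \<le> 2 * plane_norm v"
      using le(3)[of v] by simp
    finally show ?thesis .
  qed
qed simp

text \<open>
  Unless \<open>A = B\<close>, at most one entry of \<open>f\<close> is nonzero. If \<open>A\<close> is empty, then \<open>f\<close> has norm equal to the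
  modulus \<open>t \<le> 1\<close> of that entry, and adding an entry of modulus 1 gives norm at least
  \<open>(1 + t) / 2 \<ge> t\<close>. If \<open>A\<close> and \<open>B\<close> are singletons, both sides are norms of unimodular multiples of
  basis vectors.
\<close>
lemma property_A_plane:
  "basis_on.property_A fun_scale (coordinate_space 2)
    (plane_norm :: (nat \<Rightarrow> 'f::{real_normed_field,banach}) \<Rightarrow> real) 2 unit_vector"
proof -
  interpret coordinate_norm 2 "plane_norm :: (nat \<Rightarrow> 'f) \<Rightarrow> real" 2
    by (rule coordinate_norm_plane)
  show ?thesis
  proof (rule property_A_I)
    fix f \<epsilon> :: "nat \<Rightarrow> 'f" and A B :: "nat set"
    assume le: "\<And>n. norm (f n) \<le> 1" and sets: "A \<subseteq> {1..2}" "B \<subseteq> {1..2}" "card A \<le> card B" "A \<inter> B = {}"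
      and zero: "\<And>n. n \<in> A \<union> B \<Longrightarrow> f n = 0" and \<epsilon>: "\<And>n. n \<in> A \<union> B \<Longrightarrow> norm (\<epsilon> n) = 1"
    have "{1..2} = {1, 2::nat}"
      by auto
    then have "A \<in> Pow {1, 2}" "B \<in> Pow {1, 2}"
      using sets by auto
    then consider "A = B" | "A = {}" "B = {1}" | "A = {}" "B = {2}" | "A = {}" "B = {1, 2}"
      | "A = {1}" "B = {2}" | "A = {2}" "B = {1}"
      using sets(3,4) by (simp add: Pow_insert) (elim disjE; simp)
    then show "plane_norm (override_on f \<epsilon> A) \<le> plane_norm (override_on f \<epsilon> B)"
    proof cases
      case 2
      then show ?thesis
        using zero[of 1] \<epsilon>[of 1] le[of 2]
        by (simp add: plane_norm_def override_on_def norm_divide le_max_iff_disj)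
    next
      case 3
      then show ?thesis
        using zero[of 2] \<epsilon>[of 2] le[of 1]
        by (simp add: plane_norm_def override_on_def norm_divide le_max_iff_disj)
    next
      case 4
      then show ?thesis
        using zero[of 1] zero[of 2] \<epsilon>[of 1]
        by (simp add: plane_norm_def override_on_def le_max_iff_disj)
    next
      case 5
      then show ?thesis
        using zero[of 1] zero[of 2] \<epsilon>[of 1] \<epsilon>[of 2]
        by (simp add: plane_norm_def override_on_def norm_divide)
    next
      case 6
      then show ?thesis
        using zero[of 1] zero[of 2] \<epsilon>[of 1] \<epsilon>[of 2]
        by (simp add: plane_norm_def override_on_def norm_divide)
    qed simp
  qed
qed

lemma suppression_const_plane:
  "10 / 9 \<le> basis_on.suppression_const fun_scale (coordinate_space 2)
    (plane_norm :: (nat \<Rightarrow> 'f::{real_normed_field,banach}) \<Rightarrow> real) 2 unit_vector"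
proof -
  interpret coordinate_norm 2 "plane_norm :: (nat \<Rightarrow> 'f) \<Rightarrow> real" 2
    by (rule coordinate_norm_plane)
  define q :: "nat \<Rightarrow> 'f" where "q = (\<lambda>n. if n = 1 then 1 else if n = 2 then 1 / 2 else 0)"
  have "norm (1 - 1 / 4 :: 'f) = 3 / 4"
    by (simp add: norm_divide)
  then have "plane_norm q = 3 / 4"
    by (simp add: plane_norm_def q_def norm_divide)
  moreover have "1 \<le> plane_norm (\<lambda>n. if n \<in> {1} then q n else 0)"
    by (simp add: plane_norm_def q_def)
  ultimately show ?thesis
    by (intro suppression_const_ge[of q "{1}"]) (auto simp: q_def coordinate_space_def)
qed

section \<open>Dimension at least three\<close>

text \<open>
  The index \<open>i\<close> is left out of the cancelling sum so that, when \<open>v\<close> arises from \<open>f\<close> by putting a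
  unimodular scalar at a zero entry \<open>i\<close>, the second summand depends on \<open>f\<close> alone, not on \<open>i\<close>.
\<close>
definition signed_part :: "(nat \<Rightarrow> 'f::real_normed_field) \<Rightarrow> nat \<Rightarrow> real"
  where "signed_part v i = norm (v i) + norm (\<Sum>n\<in>{1, 2} - {i}. v n) / 3"

definition lattice_part :: "(nat \<Rightarrow> 'f::real_normed_field) \<Rightarrow> nat \<times> nat \<times> nat \<Rightarrow> real"
  where "lattice_part v = (\<lambda>(i, j, k). (2 * norm (v i) + 2 * norm (v j) + norm (v k)) / 3)"

definition triples :: "nat \<Rightarrow> (nat \<times> nat \<times> nat) set"
  where "triples d = {(i, j, k). {i, j, k} \<subseteq> {1..d} \<and> distinct [i, j, k]}"

definition space_norm :: "nat \<Rightarrow> (nat \<Rightarrow> 'f::real_normed_field) \<Rightarrow> real"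
  where "space_norm d v = Max (signed_part v ` {1..d} \<union> lattice_part v ` triples d)"

lemma finite_triples: "finite (triples d)"
  by (rule finite_subset[of _ "{1..d} \<times> {1..d} \<times> {1..d}"]) (auto simp: triples_def)

lemma signed_part_le_norm: "i \<in> {1..d} \<Longrightarrow> signed_part v i \<le> space_norm d v"
  unfolding space_norm_def by (rule Max_ge) (auto simp: finite_triples)

lemma lattice_part_le_norm: "t \<in> triples d \<Longrightarrow> lattice_part v t \<le> space_norm d v"
  unfolding space_norm_def by (rule Max_ge) (auto simp: finite_triples)

lemma space_norm_leI:
  assumes "d \<ge> 1" "\<And>i. i \<in> {1..d} \<Longrightarrow> signed_part v i \<le> b"
    and "\<And>t. t \<in> triples d \<Longrightarrow> lattice_part v t \<le> b"
  shows "space_norm d v \<le> b"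
  unfolding space_norm_def using assms by (subst Max_le_iff) (auto simp: finite_triples)

lemma coordinate_norm_space:
  assumes "d \<ge> 1"
  shows "coordinate_norm d (space_norm d :: (nat \<Rightarrow> 'f::{real_normed_field,banach}) \<Rightarrow> real) 1"
proof
  fix c and v w :: "nat \<Rightarrow> 'f"
  have signed_scale: "signed_part (fun_scale c v) i = norm c * signed_part v i" for i
    by (simp add: signed_part_def fun_scale_def norm_mult distrib_left flip: sum_distrib_left)
  have lattice_scale: "lattice_part (fun_scale c v) t = norm c * lattice_part v t" for t
    by (cases t) (simp add: lattice_part_def fun_scale_def norm_mult algebra_simps)
  have "space_norm d (fun_scale c v)
      = Max ((*) (norm c) ` (signed_part v ` {1..d} \<union> lattice_part v ` triples d))"
    unfolding space_norm_def image_Un image_image signed_scale lattice_scale ..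
  also have "\<dots> = norm c * space_norm d v"
    unfolding space_norm_def using assms
    by (subst mono_Max_commute[symmetric]) (auto simp: finite_triples mono_def mult_left_mono)
  finally show "space_norm d (fun_scale c v) = norm c * space_norm d v" .
  show "space_norm d (v + w) \<le> space_norm d v + space_norm d w"
  proof (rule space_norm_leI[OF assms])
    fix i assume i: "i \<in> {1..d}"
    have "signed_part (v + w) i \<le> signed_part v i + signed_part w i"
      using norm_triangle_ineq[of "v i" "w i"]
        norm_triangle_ineq[of "\<Sum>n\<in>{1, 2} - {i}. v n" "\<Sum>n\<in>{1, 2} - {i}. w n"]
      by (simp add: signed_part_def sum.distrib)
    with signed_part_le_norm[OF i, of v] signed_part_le_norm[OF i, of w]
    show "signed_part (v + w) i \<le> space_norm d v + space_norm d w"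
      by simp
  next
    fix t assume t: "t \<in> triples d"
    have "lattice_part (v + w) t \<le> lattice_part v t + lattice_part w t"
    proof (cases t)
      case (fields i j k)
      then show ?thesis
        using norm_triangle_ineq[of "v i" "w i"] norm_triangle_ineq[of "v j" "w j"]
          norm_triangle_ineq[of "v k" "w k"]
        unfolding fields lattice_part_def prod.case plus_fun_def add_divide_distrib[symmetric]
        by (intro divide_right_mono) linarith+
    qed
    with lattice_part_le_norm[OF t, of v] lattice_part_le_norm[OF t, of w]
    show "lattice_part (v + w) t \<le> space_norm d v + space_norm d w"
      by simp
  qed
  show "norm (v n) \<le> 1 * space_norm d v" if "n \<in> {1..d}" for n
    using signed_part_le_norm[OF that, of v] unfolding signed_part_def
    by (auto elim!: order_trans[rotated])
qed simp

text \<open>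
  Forgetting the cancellation turns a signed part into a weighted sum of three moduli, which can be
  compared with a lattice part: the two differ by \<open>(\<bar>v\<^sub>j\<bar> - \<bar>v\<^sub>i\<bar>) / 3\<close>, so the lattice part wins once the
  entry at \<open>j\<close> is as large as the one at \<open>i\<close>.
\<close>
lemma signed_part_le:
  assumes "d \<ge> 3" "i \<in> {1..d}"
  obtains j k where "(i, j, k) \<in> triples d"
    and "3 * signed_part v i \<le> 3 * norm (v i) + norm (v j) + norm (v k)"
proof -
  consider "i = 1" | "i = 2" | "i \<noteq> 1" "i \<noteq> 2" by blast
  then show thesis
  proof cases
    case 1
    then show thesis using assms by (intro that[of 2 3]) (auto simp: triples_def signed_part_def)
  next
    case 2
    have "{1, 2} - {i} = {1}" using 2 by auto
    then show thesis using assms 2 by (intro that[of 1 3]) (auto simp: triples_def signed_part_def)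
  next
    case 3
    then have "(\<Sum>n\<in>{1, 2} - {i}. v n) = v 1 + v 2" by simp
    then show thesis using assms 3 norm_triangle_ineq[of "v 1" "v 2"]
      by (intro that[of 1 2]) (auto simp: triples_def signed_part_def)
  qed
qed

text \<open>
  The permutation is the involution that exchanges \<open>A\<close> with an equinumerous subset of \<open>B\<close> and fixes
  everything else.
\<close>
lemma exchange_map:
  assumes "finite B" "card A \<le> card B" "A \<inter> B = {}" "finite A"
  obtains \<pi> where "inj \<pi>" "\<pi> ` A \<subseteq> B" "\<And>n. n \<in> B \<Longrightarrow> \<pi> n \<in> A \<union> B" "\<And>n. n \<notin> A \<union> B \<Longrightarrow> \<pi> n = n"
proof -
  obtain \<sigma> where \<sigma>: "inj_on \<sigma> A" "\<sigma> ` A \<subseteq> B"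
    using card_le_inj[OF assms(4,1,2)] by auto
  define \<pi> where "\<pi> = (\<lambda>n. if n \<in> A then \<sigma> n else if n \<in> \<sigma> ` A then the_inv_into A \<sigma> n else n)"
  have inv: "the_inv_into A \<sigma> (\<sigma> a) = a" if "a \<in> A" for a
    using \<sigma>(1) that by (rule the_inv_into_f_f)
  have invol: "\<pi> (\<pi> n) = n" for n
    using \<sigma>(2) assms(3) by (auto simp: \<pi>_def inv)
  show thesis
  proof
    show "inj \<pi>"
      by (metis injI invol)
  qed (use \<sigma>(2) assms(3) in \<open>auto simp: \<pi>_def inv\<close>)
qed

lemma property_A_space:
  assumes d: "d \<ge> 3"
  shows "basis_on.property_A fun_scale (coordinate_space d)
    (space_norm d :: (nat \<Rightarrow> 'f::{real_normed_field,banach}) \<Rightarrow> real) d unit_vector"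
proof -
  interpret coordinate_norm d "space_norm d :: (nat \<Rightarrow> 'f) \<Rightarrow> real" 1
    using d by (intro coordinate_norm_space) simp
  show ?thesis
  proof (rule property_A_I)
    fix f \<epsilon> :: "nat \<Rightarrow> 'f" and A B :: "nat set"
    assume le: "\<And>n. norm (f n) \<le> 1" and A: "A \<subseteq> {1..d}" and B: "B \<subseteq> {1..d}"
      and card: "card A \<le> card B" and disjoint: "A \<inter> B = {}"
      and zero: "\<And>n. n \<in> A \<union> B \<Longrightarrow> f n = 0" and \<epsilon>: "\<And>n. n \<in> A \<union> B \<Longrightarrow> norm (\<epsilon> n) = 1"
    have fin: "finite A" "finite B"
      using A B by (auto intro: finite_subset)
    define v w where "v = override_on f \<epsilon> A" and "w = override_on f \<epsilon> B"
    obtain \<pi> where \<pi>: "inj \<pi>" "\<pi> ` A \<subseteq> B" "\<And>n. n \<in> B \<Longrightarrow> \<pi> n \<in> A \<union> B"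
        "\<And>n. n \<notin> A \<union> B \<Longrightarrow> \<pi> n = n"
      using exchange_map[OF fin(2) card disjoint fin(1)] by blast
    have \<pi>_mem: "\<pi> n \<in> {1..d}" if "n \<in> {1..d}" for n
      using that \<pi>(2)[THEN subsetD, of "\<pi> n"] \<pi>(3)[of n] \<pi>(4)[of n] A B
      by (cases "n \<in> A"; cases "n \<in> B") auto
    have \<pi>_triple: "(\<pi> i, \<pi> j, \<pi> k) \<in> triples d" if "(i, j, k) \<in> triples d" for i j k
      using that \<pi>_mem by (auto simp: triples_def inj_eq[OF \<pi>(1)] simp del: atLeastAtMost_iff)
    \<comment> \<open>An index of \<open>A\<close> goes to \<open>B\<close>, where \<open>w\<close> is unimodular; \<open>v\<close> vanishes on \<open>B\<close>; elsewhere \<open>v = w = f\<close>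
      and \<open>\<pi>\<close> is the identity.\<close>
    have dominated: "norm (v n) \<le> norm (w (\<pi> n))" for n
      using \<pi>(2)[THEN subsetD, of "\<pi> n"] \<pi>(4)[of n] zero[of n] \<epsilon>[of n] \<epsilon>[of "\<pi> n"]
      by (cases "n \<in> A"; cases "n \<in> B") (auto simp: v_def w_def override_on_def)
    have v_le: "norm (v n) \<le> 1" for n
      using le[of n] \<epsilon>[of n] by (simp add: v_def override_on_def)
    have w_B: "norm (w b) = 1" if "b \<in> B" for b
      using that \<epsilon>[of b] by (simp add: w_def override_on_def)
    show "space_norm d (override_on f \<epsilon> A) \<le> space_norm d (override_on f \<epsilon> B)"
    proof (cases "B = {}")
      case True
      then show ?thesis
        using card fin by simp
    next
      case False
      have "space_norm d v \<le> space_norm d w"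
      proof (rule space_norm_leI)
        show "d \<ge> 1"
          using d by simp
      next
        fix t assume t: "t \<in> triples d"
        obtain i j k where ijk: "t = (i, j, k)"
          by (cases t)
        have "lattice_part v t \<le> lattice_part w (\<pi> i, \<pi> j, \<pi> k)"
          using dominated[of i] dominated[of j] dominated[of k]
          unfolding ijk lattice_part_def prod.case by (intro divide_right_mono) linarith+
        also have "\<dots> \<le> space_norm d w"
          using \<pi>_triple t unfolding ijk by (intro lattice_part_le_norm)
        finally show "lattice_part v t \<le> space_norm d w" .
      next
        fix i assume i: "i \<in> {1..d}"
        obtain j k where ijk: "(i, j, k) \<in> triples d"
          and signed: "3 * signed_part v i \<le> 3 * norm (v i) + norm (v j) + norm (v k)"
          using signed_part_le[OF d i] by blast
        note triple = \<pi>_triple[OF ijk]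
        note bounds = signed dominated[of i] dominated[of j] dominated[of k] v_le[of i] v_le[of j] v_le[of k]
        \<comment> \<open>A unimodular entry of \<open>w\<close> away from \<open>\<pi> i\<close> can serve as the second large entry of a lattice
          part, which then dominates. Only \<open>B = {\<pi> i}\<close> leaves no such entry.\<close>
        consider (jk) "\<pi> j \<in> B \<or> \<pi> k \<in> B" | (fourth) b where "b \<in> B" "b \<notin> {\<pi> i, \<pi> j, \<pi> k}"
          | (only_i) "B = {\<pi> i}"
          using False by blast
        then show "signed_part v i \<le> space_norm d w"
        proof cases
          case jk
          have "(\<pi> i, \<pi> k, \<pi> j) \<in> triples d"
            using triple by (auto simp: triples_def)
          from lattice_part_le_norm[OF this, of w] lattice_part_le_norm[OF triple, of w] jk bounds
          show ?thesis
            by (auto simp: lattice_part_def w_B)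
        next
          case fourth
          then have "(\<pi> i, b, \<pi> j) \<in> triples d"
            using triple B by (auto simp: triples_def)
          from lattice_part_le_norm[OF this, of w] bounds
          show ?thesis
            by (simp add: lattice_part_def w_B fourth(1))
        next
          case only_i
          show ?thesis
          proof (cases "v i = 0")
            case True
            with lattice_part_le_norm[OF triple, of w] bounds show ?thesis
              by (simp add: lattice_part_def w_B only_i)
                (use norm_ge_zero[of "w (\<pi> j)"] in linarith)
          next
            case False
            \<comment> \<open>Here \<open>A = {i}\<close>, and the signed parts of \<open>v\<close> and \<open>w\<close> at the exchanged indices have the same
              second summand.\<close>
            have "i \<in> A"
            proof (rule ccontr)
              assume "i \<notin> A"
              with False zero[of i] have "i \<notin> A \<union> B"
                by (auto simp: v_def override_on_def)
              with \<pi>(4)[of i] only_i show False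
                by auto
            qed
            have "card A \<le> 1"
              using card only_i by simp
            then have "A = {i}"
              using \<open>i \<in> A\<close> fin(1) by (auto simp: card_le_Suc0_iff_eq)
            have "(\<Sum>n\<in>{1, 2} - {i}. v n) = (\<Sum>n\<in>{1, 2}. f n)"
              using zero[of i] \<open>A = {i}\<close> by (intro sum.mono_neutral_cong_left) (auto simp: v_def)
            moreover have "(\<Sum>n\<in>{1, 2} - {\<pi> i}. w n) = (\<Sum>n\<in>{1, 2}. f n)"
              using zero[of "\<pi> i"] only_i by (intro sum.mono_neutral_cong_left) (auto simp: w_def)
            ultimately have "signed_part v i \<le> signed_part w (\<pi> i)"
              using dominated[of i] by (simp add: signed_part_def)
            also have "\<dots> \<le> space_norm d w"
              using i by (intro signed_part_le_norm \<pi>_mem)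
            finally show ?thesis .
          qed
        qed
      qed
      then show ?thesis
        by (simp add: v_def w_def)
    qed
  qed
qed

lemma suppression_const_space:
  assumes d: "d \<ge> 3"
  shows "10 / 9 \<le> basis_on.suppression_const fun_scale (coordinate_space d)
    (space_norm d :: (nat \<Rightarrow> 'f::{real_normed_field,banach}) \<Rightarrow> real) d unit_vector"
proof -
  interpret coordinate_norm d "space_norm d :: (nat \<Rightarrow> 'f) \<Rightarrow> real" 1
    using d by (intro coordinate_norm_space) simp
  define q :: "nat \<Rightarrow> 'f" where
    "q = (\<lambda>n. if n = 1 then 1 / 3 else if n = 2 then - 1 / 3 else if n = 3 then 1 else 0)"
  have norm_q: "norm (q n) = (if n = 3 then 1 else if n \<in> {1, 2} then 1 / 3 else 0)" for n
    by (simp add: q_def norm_divide)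
  have "space_norm d q \<le> 1"
  proof (rule space_norm_leI)
    fix i :: nat
    consider "i = 1" | "i = 2" | "i \<noteq> 1" "i \<noteq> 2" by blast
    then show "signed_part q i \<le> 1"
    proof cases
      case 1
      then show ?thesis by (simp add: signed_part_def norm_q)
    next
      case 2
      have "{1, 2} - {i} = {1}" using 2 by auto
      then show ?thesis using 2 by (simp add: signed_part_def norm_q)
    next
      case 3
      then have "(\<Sum>n\<in>{1, 2} - {i}. q n) = 0" by (simp add: q_def)
      then show ?thesis using 3 by (simp add: signed_part_def norm_q)
    qed
  qed (use d in \<open>auto simp: lattice_part_def triples_def norm_q\<close>)
  moreover have "10 / 9 \<le> space_norm d (\<lambda>n. if n \<in> {1, 3} then q n else 0)"
    using d signed_part_le_norm[of 3 d "\<lambda>n. if n \<in> {1, 3} then q n else 0"]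
    by (simp add: signed_part_def norm_q)
  moreover have "0 < space_norm d q"
    using d coordinate_le[of 3 q] by (simp add: norm_q)
  ultimately show ?thesis
    using d by (intro suppression_const_ge[of q "{1, 3}"]) (auto simp: q_def coordinate_space_def)
qed

lemma exists_property_A_basis_with_large_suppression_const:
  assumes "d \<ge> 2"
  shows "\<exists>(V :: (nat \<Rightarrow> 'f::{real_normed_field,banach}) set) N x.
        banach_space_on fun_scale V N \<and>
        vector_space.dim fun_scale V = d \<and>
        basis_on fun_scale V N d x \<and>
        basis_on.property_A fun_scale V N d x \<and>
        basis_on.suppression_const fun_scale V N d x \<ge> 10 / 9"
proof (cases "d = 2")
  case True
  show ?thesis
    unfolding True
    by (rule coordinate_norm_example[OF coordinate_norm_plane property_A_plane suppression_const_plane])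
next
  case False
  with assms have "d \<ge> 3" "d \<ge> 1"
    by simp_all
  then show ?thesis
    by (intro coordinate_norm_example[OF coordinate_norm_space property_A_space
          suppression_const_space])
qed

theorem proposition4p1:
  fixes d :: nat
  assumes "d \<ge> 2"
  shows
    "(\<exists>(V :: (nat \<Rightarrow> real) set) N x.
        banach_space_on fun_scale V N \<and>
        vector_space.dim fun_scale V = d \<and>
        basis_on fun_scale V N d x \<and>
        basis_on.property_A fun_scale V N d x \<and>
        basis_on.suppression_const fun_scale V N d x \<ge> 10 / 9) \<and>
     (\<exists>(V :: (nat \<Rightarrow> complex) set) N x.
        banach_space_on fun_scale V N \<and>
        vector_space.dim fun_scale V = d \<and>
        basis_on fun_scale V N d x \<and>
        basis_on.property_A fun_scale V N d x \<and>
        basis_on.suppression_const fun_scale V N d x \<ge> 10 / 9)"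
  by (intro conjI exists_property_A_basis_with_large_suppression_const assms)

end
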